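(* Let $(\Gamma,B)$ be a balanced graph, where $\Gamma$ is a finite $3$-valent graph. Then the number of vertices of $\Gamma$ whose multiplicity equals the minimum of the multiplicities of all vertices of $\Gamma$ is even.
   Context: $\mathbb{Z}_2$ denotes the ring of $2$-adic integers and $\nu_2$ the $2$-adic valuation (with $\nu_2(0)=\infty$). A $3$-valent graph (multiple edges allowed) is regarded as directed by replacing each undirected edge $e$ with two opposite directed edges $e^+,e^-$; each vertex is then the terminal vertex of exactly three directed edges. A balancing function on $\Gamma$ is a function $B$ assigning to every directed edge a vector $B(e)=(B_x(e),B_y(e))\in\mathbb{Z}_2\oplus\mathbb{Z}_2$ such that (i) $B(e^+)+B(e^-)=0$ for the two directed edges $e^\pm$ of each undirected edge, and (ii) $B(e_1)+B(e_2)+B(e_3)=0$ whenever $e_1,e_2,e_3$ are the three directed edges with the same terminal vertex. The pair $(\Gamma,B)$ is called a balanced graph. If $e_1,e_2,e_3$ are the directed edges terminating at a vertex $v$, the multiplicity of $v$ is $m(v)=\nu_2\big(B_x(e_1)B_y(e_2)-B_y(e_1)B_x(e_2)\big)\in\mathbb{Z}_{\ge 0}\cup\{\infty\}$ (independent of the choice of two of the three edges); $\infty$ is regarded as larger than every finite value. *)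

theory Defs
  imports
    "HOL-Library.Extended_Nat"
    "HOL-Library.Product_Plus"
    "Graph_Theory.Bidirected_Digraph"
begin

text \<open>
  The ring of 2-adic integers, as the inverse limit of the rings of residues modulo
  \<open>2 ^ n\<close>. A residue is represented by its least nonnegative representative; the
  compatibility condition already forces \<open>0 \<le> x n < 2 ^ n\<close>.
\<close>

typedef two_adic_int = "{x :: nat \<Rightarrow> int. \<forall>n. x (Suc n) mod 2 ^ n = x n}"
  morphisms residue Abs_two_adic_int
  by (rule exI[of _ "\<lambda>_. 0"]) simp

setup_lifting type_definition_two_adic_int

lemma mod_power_Suc_mod: "(a mod 2 ^ Suc n) mod 2 ^ n = a mod (2 ^ n :: int)"
  by (rule mod_mod_cancel) simp

instantiation two_adic_int :: comm_ring_1
begin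

lift_definition zero_two_adic_int :: two_adic_int is "\<lambda>n. 0"
  by simp

lift_definition one_two_adic_int :: two_adic_int is "\<lambda>n. 1 mod 2 ^ n"
  by (simp only: mod_power_Suc_mod)

lift_definition plus_two_adic_int :: "two_adic_int \<Rightarrow> two_adic_int \<Rightarrow> two_adic_int"
  is "\<lambda>x y n. (x n + y n) mod 2 ^ n"
  by (simp only: mod_power_Suc_mod) (metis mod_add_eq)

lift_definition uminus_two_adic_int :: "two_adic_int \<Rightarrow> two_adic_int"
  is "\<lambda>x n. (- x n) mod 2 ^ n"
  by (simp only: mod_power_Suc_mod) (metis mod_minus_eq)

lift_definition minus_two_adic_int :: "two_adic_int \<Rightarrow> two_adic_int \<Rightarrow> two_adic_int"
  is "\<lambda>x y n. (x n - y n) mod 2 ^ n"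
  by (simp only: mod_power_Suc_mod) (metis mod_diff_eq)

lift_definition times_two_adic_int :: "two_adic_int \<Rightarrow> two_adic_int \<Rightarrow> two_adic_int"
  is "\<lambda>x y n. (x n * y n) mod 2 ^ n"
  by (simp only: mod_power_Suc_mod) (metis mod_mult_eq)

lemma compatible_mod_self:
  assumes "\<forall>n. x (Suc n) mod 2 ^ n = (x n :: int)"
  shows "x n mod 2 ^ n = x n"
  using assms by (metis mod_mod_trivial)

lemma compatible_0:
  assumes "\<forall>n. x (Suc n) mod 2 ^ n = (x n :: int)"
  shows "x 0 = 0"
  using compatible_mod_self[OF assms, of 0] by simp

instance
proof
  fix a b c :: two_adic_int
  show "a * b * c = a * (b * c)"
    by transfer (simp add: fun_eq_iff mod_simps mult.assoc)
  show "a * b = b * a"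
    by transfer (simp add: fun_eq_iff mult.commute)
  show "1 * a = a"
    by transfer (simp add: fun_eq_iff mod_simps compatible_mod_self compatible_0)
  show "a + b + c = a + (b + c)"
    by transfer (simp add: fun_eq_iff mod_simps add.assoc)
  show "a + b = b + a"
    by transfer (simp add: fun_eq_iff add.commute)
  show "0 + a = a"
    by transfer (simp add: fun_eq_iff compatible_mod_self)
  show "- a + a = 0"
    by transfer (simp add: fun_eq_iff mod_simps)
  show "a - b = a + - b"
    by transfer (simp add: fun_eq_iff mod_simps)
  show "(a + b) * c = a * c + b * c"
    by transfer (simp add: fun_eq_iff mod_simps distrib_right)
  show "(0::two_adic_int) \<noteq> 1"
  proof transfer
    have "(0::int) \<noteq> 1 mod 2 ^ 1" by simp
    then show "(\<lambda>n. 0) \<noteq> (\<lambda>n. 1 mod 2 ^ n :: int)" by metis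
  qed
qed

end

text \<open>The greatest exponent exists for \<open>x \<noteq> 0\<close>, see \<open>le_val2_iff\<close> below.\<close>

definition val2 :: "two_adic_int \<Rightarrow> enat" where
  "val2 x = (if x = 0 then \<infinity> else enat (GREATEST n. 2 ^ n dvd x))"

lemma residue_of_nat: "residue (of_nat k) n = int k mod 2 ^ n"
proof (induction k)
  case 0
  show ?case by (simp add: zero_two_adic_int.rep_eq)
next
  case (Suc k)
  then show ?case
    by (simp add: plus_two_adic_int.rep_eq one_two_adic_int.rep_eq mod_simps)
qed

lemma residue_power_two_mult: "residue (2 ^ k * y) n = (2 ^ k * residue y n) mod 2 ^ n"
proof -
  have "residue (2 ^ k * y) n = residue (of_nat (2 ^ k) * y) n"
    by simp
  also have "\<dots> = (2 ^ k * residue y n) mod 2 ^ n"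
    unfolding times_two_adic_int.rep_eq residue_of_nat by (simp add: mod_simps)
  finally show ?thesis .
qed

lemma residue_Suc: "residue x (Suc n) mod 2 ^ n = residue x n"
  using residue[of x] by simp

lemma residue_add_mod: "residue x (m + n) mod 2 ^ n = residue x n"
proof (induction m)
  case 0
  show ?case using compatible_mod_self[of "residue x"] residue_Suc by simp
next
  case (Suc m)
  have "residue x (Suc m + n) mod 2 ^ n = residue x (Suc (m + n)) mod 2 ^ (m + n) mod 2 ^ n"
    by (simp add: mod_mod_cancel le_imp_power_dvd)
  with Suc show ?case by (simp add: residue_Suc)
qed

lemma power_two_dvd_iff_residue: "2 ^ n dvd x \<longleftrightarrow> residue x n = 0"
proof
  assume "2 ^ n dvd x"
  then obtain y where "x = 2 ^ n * y" by (elim dvdE)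
  then show "residue x n = 0" by (simp add: residue_power_two_mult)
next
  assume x0: "residue x n = 0"
  define f where "f m = residue x (m + n) div 2 ^ n" for m
  have "f (Suc m) mod 2 ^ m = f m" for m
  proof -
    have "residue x (m + n) = residue x (Suc m + n) mod (2 ^ n * 2 ^ m)"
      using residue_Suc[of x "m + n"] by (simp add: power_add mult.commute)
    also have "\<dots> = 2 ^ n * (f (Suc m) mod 2 ^ m) + residue x (Suc m + n) mod 2 ^ n"
      unfolding f_def by (subst zmod_zmult2_eq) simp_all
    also have "residue x (Suc m + n) mod 2 ^ n = 0"
      using x0 by (simp only: residue_add_mod)
    finally show ?thesis by (simp add: f_def)
  qed
  then have f: "residue (Abs_two_adic_int f) = f"
    by (intro Abs_two_adic_int_inverse) simp
  have "x = 2 ^ n * Abs_two_adic_int f"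
  proof (rule residue_inject[THEN iffD1], rule ext)
    fix m
    have "2 ^ n * f m = residue x (m + n)"
      using x0 residue_add_mod[of x m n] unfolding f_def
      by (metis dvd_mult_div_cancel mod_0_imp_dvd)
    then show "residue x m = residue (2 ^ n * Abs_two_adic_int f) m"
      using residue_add_mod[of x n m] by (simp add: residue_power_two_mult f add.commute)
  qed
  then show "2 ^ n dvd x" by simp
qed

lemma le_val2_iff: "enat n \<le> val2 x \<longleftrightarrow> 2 ^ n dvd x"
proof (cases "x = 0")
  case True
  then show ?thesis by (simp add: val2_def)
next
  case False
  then obtain k where k: "residue x k \<noteq> 0"
    by (metis ext residue_inject zero_two_adic_int.rep_eq)
  have down: "2 ^ m dvd x" if "2 ^ n dvd x" "m \<le> n" for m n
    using that by (meson dvd_trans le_imp_power_dvd)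
  have bound: "n \<le> k" if "2 ^ n dvd x" for n
    using down[OF that, of k] k by (metis linear power_two_dvd_iff_residue)
  let ?g = "GREATEST n. 2 ^ n dvd x"
  have g: "2 ^ ?g dvd x"
    by (rule GreatestI_nat[where P = "\<lambda>n. 2 ^ n dvd x" and k = 0 and b = k])
      (simp, rule bound)
  have "n \<le> ?g" if "2 ^ n dvd x"
    by (rule Greatest_le_nat[where P = "\<lambda>n. 2 ^ n dvd x" and b = k, OF that]) (rule bound)
  with down[OF g] have "n \<le> ?g \<longleftrightarrow> 2 ^ n dvd x" by blast
  with False show ?thesis by (simp add: val2_def)
qed

lemma val2_minus: "val2 (- x) = val2 x"
  by (simp add: val2_def)

text \<open>
  An undirected multigraph is given by its directed edges together with the involution
  \<open>arev\<close> exchanging the two orientations \<open>e\<^sup>+\<close>, \<open>e\<^sup>-\<close> of each undirected edge. A loop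
  also yields two distinct directed edges, both terminating at its vertex. The locale
  \<open>bidirected_digraph\<close> makes \<open>arev\<close> fixed-point free on the arcs, and the identity elsewhere.
\<close>

locale trivalent_graph = bidirected_digraph G arev
  for G :: "('v, 'e) pre_digraph" and arev :: "'e \<Rightarrow> 'e" +
  assumes trivalent: "v \<in> verts G \<Longrightarrow> in_degree G v = 3"

locale balanced_graph = trivalent_graph G arev
  for G :: "('v, 'e) pre_digraph" and arev :: "'e \<Rightarrow> 'e" +
  fixes B :: "'e \<Rightarrow> two_adic_int \<times> two_adic_int"
  assumes balanced_edge: "e \<in> arcs G \<Longrightarrow> B e + B (arev e) = 0"
    and balanced_vertex: "v \<in> verts G \<Longrightarrow> (\<Sum>e\<in>in_arcs G v. B e) = 0"

definition det2 :: "'a::comm_ring_1 \<times> 'a \<Rightarrow> 'a \<times> 'a \<Rightarrow> 'a" where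
  "det2 a b = fst a * snd b - snd a * fst b"

text \<open>
  The choice of two of the three edges is immaterial, see \<open>vertex_mult_eq\<close> below.
\<close>

definition vertex_mult ::
  "('v, 'e) pre_digraph \<Rightarrow> ('e \<Rightarrow> two_adic_int \<times> two_adic_int) \<Rightarrow> 'v \<Rightarrow> enat" where
  "vertex_mult G B v =
    (let (e1, e2) = (SOME (e1, e2). e1 \<in> in_arcs G v \<and> e2 \<in> in_arcs G v \<and> e1 \<noteq> e2)
     in val2 (det2 (B e1) (B e2)))"

lemma det2_swap: "det2 b a = - det2 a b"
  by (simp add: det2_def algebra_simps)

lemma det2_balanced:
  assumes "a + b + c = 0"
  shows "det2 b c = det2 a b"
proof -
  have c: "c = - (a + b)" using assms by (metis minus_unique)
  show ?thesis by (simp add: c det2_def algebra_simps)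
qed

context balanced_graph
begin

lemma val2_det2_third:
  assumes v: "v \<in> verts G" and arcs: "in_arcs G v = {a, b, c}"
    and ne: "a \<noteq> b" "a \<noteq> c" "b \<noteq> c"
    and e: "e1 \<in> {a, b, c}" "e2 \<in> {a, b, c}" "e1 \<noteq> e2"
  shows "val2 (det2 (B e1) (B e2)) = val2 (det2 (B a) (B b))"
proof -
  have "B a + B b + B c = 0"
    using balanced_vertex[OF v] ne by (simp add: arcs add.assoc)
  then have bc: "det2 (B b) (B c) = det2 (B a) (B b)"
    and ca: "det2 (B c) (B a) = det2 (B a) (B b)"
    using det2_balanced[of "B a" "B b" "B c"] det2_balanced[of "B b" "B c" "B a"]
    by (simp_all add: ac_simps)
  have swap: "val2 (det2 y x) = val2 (det2 x y)" for x y
    by (metis det2_swap val2_minus)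
  have "val2 (det2 (B b) (B c)) = val2 (det2 (B a) (B b))"
    "val2 (det2 (B c) (B a)) = val2 (det2 (B a) (B b))"
    by (simp_all only: bc ca)
  with e swap show ?thesis by (elim insertE emptyE) (simp_all only: simp_thms)
qed

lemma vertex_mult_eq:
  assumes v: "v \<in> verts G" and e: "e1 \<in> in_arcs G v" "e2 \<in> in_arcs G v" "e1 \<noteq> e2"
  shows "vertex_mult G B v = val2 (det2 (B e1) (B e2))"
proof -
  obtain a b c where abc: "in_arcs G v = {a, b, c}" "a \<noteq> b" "a \<noteq> c" "b \<noteq> c"
    using trivalent[OF v] by (auto simp: in_degree_def card_3_iff)
  let ?P = "\<lambda>p. case p of (e1, e2) \<Rightarrow> e1 \<in> in_arcs G v \<and> e2 \<in> in_arcs G v \<and> e1 \<noteq> e2"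
  obtain f1 f2 where f: "(SOME p. ?P p) = (f1, f2)" by (cases "SOME p. ?P p")
  have "?P (SOME p. ?P p)" using e by (intro someI[of ?P "(e1, e2)"]) simp
  then have "f1 \<in> in_arcs G v" "f2 \<in> in_arcs G v" "f1 \<noteq> f2" by (simp_all add: f del: in_in_arcs_conv)
  then have "val2 (det2 (B f1) (B f2)) = val2 (det2 (B e1) (B e2))"
    using val2_det2_third[OF v abc, of f1 f2] val2_det2_third[OF v abc, of e1 e2] e
    unfolding abc(1) by (simp only: simp_thms)
  then show ?thesis unfolding vertex_mult_def f by simp
qed

end

end

theory Submission
  imports Defs "HOL-Number_Theory.Cong"
begin

text \<open>
  Let \<open>m\<close> be the minimal multiplicity. If \<open>m = \<infinity>\<close>, every vertex counts, and a finite trivalent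
  graph has an even number of vertices. If \<open>m\<close> is finite, put \<open>N = m + 1\<close>. There is a function
  \<open>F\<close> on pairs of residues modulo \<open>2 ^ N\<close>, odd modulo \<open>2 ^ N\<close>, such that
  \<open>F a + F b + F c \<equiv> det (a, b)\<close> modulo \<open>2 ^ N\<close> whenever \<open>a + b + c = 0\<close> and \<open>2 ^ m\<close> divides
  \<open>det (a, b)\<close>. Summing \<open>F (B e)\<close> over all directed edges, the two orientations of each edge
  cancel, whereas grouping by terminal vertex gives \<open>2 ^ m\<close> times the number of vertices of
  multiplicity \<open>m\<close>; so this number is even.

  For \<open>a = (x, x * s)\<close> with a 2-adic slope \<open>s\<close>, which need not be integral, \<open>F a / 2 ^ N\<close> is
  \<open>x * (\<Sum>i. s\<^bsub>m - 2 * i\<^esub> / 2 ^ (i + 1))\<close> modulo 1, where \<open>s\<^bsub>j\<^esub>\<close> is the \<open>j\<close>-th binary digit of \<open>s\<close>;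
  for \<open>x = 0\<close> it is 0. If \<open>a\<close> and \<open>c\<close> have the first coordinates with the fewest factors 2, say
  \<open>2 ^ p\<close>, then their slopes differ by \<open>2 ^ (m - 2 * p)\<close> times a unit if \<open>det (a, b) / 2 ^ m\<close> is odd,
  and the change of that digit contributes \<open>1 / 2\<close>.
\<close>

section \<open>Digit sums over every second binary digit\<close>

text \<open>
  \<open>digit_sum n t / 2 ^ n\<close> is \<open>t\<^bsub>n - 1\<^esub> / 2 + t\<^bsub>n - 3\<^esub> / 4 + t\<^bsub>n - 5\<^esub> / 8 + \<dots>\<close> for the binary digits
  \<open>t\<^bsub>j\<^esub>\<close> of \<open>t\<close>.
\<close>

fun digit_sum :: "nat \<Rightarrow> int \<Rightarrow> int" where
  "digit_sum 0 t = 0"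
| "digit_sum (Suc 0) t = t mod 2"
| "digit_sum (Suc (Suc n)) t = 2 ^ Suc n * (t div 2 ^ Suc n mod 2) + 2 * digit_sum n t"

lemma digit_sum_add_power: "digit_sum n (t + 2 ^ n * w) = digit_sum n t"
proof (induction n t arbitrary: w rule: digit_sum.induct)
  case (3 n t)
  have "(t + 2 ^ Suc (Suc n) * w) div 2 ^ Suc n = t div 2 ^ Suc n + 2 * w"
    using div_mult_self2[of "2 ^ Suc n" t "2 * w"] by (simp add: mult_ac)
  moreover have "digit_sum n (t + 2 ^ Suc (Suc n) * w) = digit_sum n t"
    using "3.IH"[of "4 * w"] by (simp add: mult_ac)
  ultimately show ?case by simp
qed simp_all

lemma digit_sum_cong:
  assumes "[s = t] (mod 2 ^ n)"
  shows "digit_sum n s = digit_sum n t"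
proof -
  obtain k where "s = t + 2 ^ n * k"
    using assms by (metis cong_iff_lin cong_sym)
  then show ?thesis by (simp add: digit_sum_add_power)
qed

text \<open>Digit \<open>n\<close> has weight \<open>2 ^ n\<close>, so only the parity of
  \<open>w\<close> counts; the other digits read lie below \<open>n\<close> and do not
  change.\<close>

lemma digit_sum_add_half_power:
  "[digit_sum (Suc n) (t + 2 ^ n * w) = digit_sum (Suc n) t + 2 ^ n * w] (mod 2 ^ Suc n)"
proof (cases n)
  case 0
  then show ?thesis by (simp add: cong_def mod_simps)
next
  case (Suc k)
  have digits: "digit_sum (Suc n) s = 2 ^ n * (s div 2 ^ n mod 2) + 2 * digit_sum k s" for s
    by (simp only: Suc digit_sum.simps)
  have low: "digit_sum k (t + 2 ^ n * w) = digit_sum k t"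
    using digit_sum_add_power[of k t "2 * w"] by (simp add: Suc mult_ac)
  have "[2 ^ n * ((t div 2 ^ n + w) mod 2) = 2 ^ n * (t div 2 ^ n mod 2 + w)] (mod 2 ^ n * 2)"
    by (rule cong_cmult_leftI) (simp add: cong_def mod_simps)
  from cong_add[OF this cong_refl[of "2 * digit_sum k t"]] show ?thesis
    unfolding digits low by (simp add: algebra_simps)
qed

lemma digit_sum_double: "digit_sum (Suc n) (2 * t) = 2 * digit_sum n t"
proof (induction n t rule: digit_sum.induct)
  case (3 n t)
  then show ?case by (cases n) (auto simp: zdiv_zmult2_eq)
qed simp_all

lemma digit_sum_Suc_cong: "[digit_sum n (2 * t) = digit_sum (Suc n) t] (mod 2 ^ n)"
proof (cases n)
  case (Suc k)
  then show ?thesis using digit_sum_double[of k t] by (simp add: cong_def)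
qed (simp add: cong_def)

text \<open>Serves to compare one slope written over two denominators, \<open>2 ^ p\<close> and
  \<open>2 ^ (p + d)\<close>.\<close>

lemma digit_sum_power_mult_cong:
  "[digit_sum n (2 ^ d * t) = digit_sum (n + d) t] (mod 2 ^ n)"
proof (induction d arbitrary: t)
  case (Suc d)
  have "[digit_sum n (2 ^ d * (2 * t)) = digit_sum (n + d) (2 * t)] (mod 2 ^ n)"
    by (rule Suc)
  also have "[digit_sum (n + d) (2 * t) = digit_sum (n + Suc d) t] (mod 2 ^ n)"
    using digit_sum_Suc_cong[of "n + d" t] by (auto intro: cong_dvd_modulus simp: power_add)
  finally show ?case by (simp add: mult_ac)
qed simp

section \<open>Slopes modulo a power of 2\<close>

text \<open>
  The slope \<open>y / x\<close> is \<open>t / 2 ^ p\<close>. The case \<open>p = N\<close> means \<open>x \<equiv> 0\<close>, with no condition on \<open>y\<close>.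
\<close>

definition slope_rep :: "nat \<Rightarrow> int \<Rightarrow> int \<Rightarrow> nat \<Rightarrow> int \<Rightarrow> int \<Rightarrow> bool" where
  "slope_rep N x y p u t \<longleftrightarrow>
    p \<le> N \<and> odd u \<and> [x = 2 ^ p * u] (mod 2 ^ N) \<and> [y = u * t] (mod 2 ^ (N - p))"

lemma odd_solve_cong:
  fixes u y :: int
  assumes "odd u"
  obtains t where "[y = u * t] (mod 2 ^ n)"
proof -
  have "coprime u (2 ^ n)" using assms by simp
  then obtain i where "[u * i = 1] (mod 2 ^ n)"
    using cong_solve_coprime_int by blast
  then have "[u * i * y = 1 * y] (mod 2 ^ n)" by (rule cong_scalar_right)
  then show ?thesis by (intro that[of "i * y"]) (simp add: cong_sym_eq mult.assoc)
qed

lemma odd_cancel_cong: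
  fixes u :: int
  assumes "odd u" "[u * s = u * t] (mod 2 ^ n)"
  shows "[s = t] (mod 2 ^ n)"
  using assms cong_mult_lcancel[of u "2 ^ n" s t] by simp

lemma slope_rep_exists: obtains p u t where "slope_rep N x y p u t"
proof (cases "2 ^ N dvd x")
  case True
  then have "slope_rep N x y N 1 y" by (simp add: slope_rep_def cong_def)
  then show ?thesis by (rule that)
next
  case False
  then have "x \<noteq> 0" by auto
  define p where "p = multiplicity 2 x"
  obtain u where u: "x = 2 ^ p * u" "\<not> 2 dvd u"
    using multiplicity_decompose'[of x 2] \<open>x \<noteq> 0\<close> unfolding p_def by auto
  have "p < N" using False u(1) by (metis dvd_triv_left le_imp_power_dvd dvd_trans not_less)
  obtain t where "[y = u * t] (mod 2 ^ (N - p))" using odd_solve_cong u(2) by blast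
  then have "slope_rep N x y p u t" using \<open>p < N\<close> u by (simp add: slope_rep_def)
  then show ?thesis by (rule that)
qed

lemma slope_rep_cong:
  assumes "slope_rep N x y p u t" "[x' = x] (mod 2 ^ N)" "[y' = y] (mod 2 ^ N)"
  shows "slope_rep N x' y' p u t"
proof -
  have "[y' = y] (mod 2 ^ (N - p))"
    using assms(3) by (rule cong_dvd_modulus) (simp add: le_imp_power_dvd)
  then show ?thesis
    using assms(1,2) unfolding slope_rep_def by (blast intro: cong_trans)
qed

lemma slope_rep_minus:
  "slope_rep N x y p u t \<Longrightarrow> slope_rep N (- x) (- y) p (- u) t"
  unfolding slope_rep_def by (simp add: cong_minus_minus_iff)

lemma power_cong_cmult:
  fixes a b :: int
  assumes "p \<le> N"
  shows "[2 ^ p * a = 2 ^ p * b] (mod 2 ^ N) \<longleftrightarrow> [a = b] (mod 2 ^ (N - p))"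
proof -
  have "(2::int) ^ N = 2 ^ p * 2 ^ (N - p)" using assms by (simp flip: power_add)
  then show ?thesis
    by (simp add: cong_iff_dvd_diff right_diff_distrib[symmetric])
qed

lemma slope_rep_dvd_iff:
  assumes "slope_rep N x y p u t" "k \<le> N"
  shows "2 ^ k dvd x \<longleftrightarrow> k \<le> p"
proof -
  have "2 ^ k dvd x \<longleftrightarrow> 2 ^ k dvd 2 ^ p * u"
    by (rule cong_dvd_iff, rule cong_dvd_modulus[of x _ "2 ^ N"])
      (use assms in \<open>simp_all add: slope_rep_def le_imp_power_dvd\<close>)
  also have "\<dots> \<longleftrightarrow> k \<le> p"
  proof
    assume dvd: "2 ^ k dvd 2 ^ p * u"
    show "k \<le> p"
    proof (rule ccontr)
      assume "\<not> k \<le> p"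
      then have "(2::int) ^ Suc p dvd 2 ^ k" by (intro le_imp_power_dvd) simp
      then have "2 ^ Suc p dvd 2 ^ p * u" using dvd by (rule dvd_trans)
      then have "even u" by (simp add: mult.commute[of 2])
      then show False using assms(1) by (simp add: slope_rep_def)
    qed
  qed (simp add: le_imp_power_dvd dvd_mult2)
  finally show ?thesis .
qed

lemma slope_rep_exponent_unique:
  assumes "slope_rep N x y p u t" "slope_rep N x y p' u' t'"
  shows "p = p'"
  using assms slope_rep_dvd_iff[OF assms(1), of p'] slope_rep_dvd_iff[OF assms(2), of p]
    slope_rep_dvd_iff[OF assms(1), of p] slope_rep_dvd_iff[OF assms(2), of p']
  by (auto simp: slope_rep_def)

text \<open>Since \<open>2 ^ p * u\<close> is fixed modulo \<open>2 ^ N\<close>, \<open>u\<close>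
  and hence \<open>t\<close> are fixed modulo \<open>2 ^ (N - p)\<close>, and
  \<open>digit_sum (N - p)\<close> reads no further digit.\<close>

lemma slope_rep_unique:
  assumes "slope_rep N x y p u t" "slope_rep N x y p' u' t'"
  shows "[2 ^ p * u * digit_sum (N - p) t = 2 ^ p' * u' * digit_sum (N - p') t'] (mod 2 ^ N)"
proof -
  have p: "p' = p"
    by (rule slope_rep_exponent_unique[OF assms(2,1)])
  have pu: "[2 ^ p * u = 2 ^ p * u'] (mod 2 ^ N)"
    using assms unfolding slope_rep_def p by (blast intro: cong_trans cong_sym)
  then have u: "[u = u'] (mod 2 ^ (N - p))"
    using assms(1) by (simp add: power_cong_cmult slope_rep_def)
  have "[u * t = u * t'] (mod 2 ^ (N - p))"
    using assms cong_scalar_right[OF u, of t'] unfolding slope_rep_def p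
    by (blast intro: cong_trans cong_sym)
  then have "[t = t'] (mod 2 ^ (N - p))"
    using assms(1) by (auto simp: slope_rep_def dest: odd_cancel_cong)
  then show ?thesis using cong_scalar_right[OF pu] by (simp add: p digit_sum_cong)
qed

section \<open>The odd function on pairs of residues\<close>

text \<open>Only the class of the chosen value modulo \<open>2 ^ N\<close> is determined.\<close>

definition potential :: "nat \<Rightarrow> int \<Rightarrow> int \<Rightarrow> int" where
  "potential N x y =
    (SOME k. \<exists>p u t. slope_rep N x y p u t \<and> k = 2 ^ p * u * digit_sum (N - p) t)"

lemma potential_slope_rep:
  assumes "slope_rep N x y p u t"
  shows "[potential N x y = 2 ^ p * u * digit_sum (N - p) t] (mod 2 ^ N)"
proof -
  have "\<exists>k p u t. slope_rep N x y p u t \<and> k = 2 ^ p * u * digit_sum (N - p) t"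
    using assms by blast
  from someI_ex[OF this] obtain p' u' t'
    where r: "slope_rep N x y p' u' t'" "potential N x y = 2 ^ p' * u' * digit_sum (N - p') t'"
    unfolding potential_def[symmetric] by blast
  show ?thesis unfolding r(2) by (rule slope_rep_unique[OF r(1) assms])
qed

lemma potential_cong:
  assumes "[x' = x] (mod 2 ^ N)" "[y' = y] (mod 2 ^ N)"
  shows "[potential N x' y' = potential N x y] (mod 2 ^ N)"
proof -
  obtain p u t where "slope_rep N x y p u t" by (rule slope_rep_exists)
  then show ?thesis
    using potential_slope_rep slope_rep_cong[OF _ assms] by (blast intro: cong_trans cong_sym)
qed

lemma potential_minus: "[potential N (- x) (- y) = - potential N x y] (mod 2 ^ N)"
proof -
  obtain p u t where r: "slope_rep N x y p u t" by (rule slope_rep_exists)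
  have "[- potential N x y = - (2 ^ p * u * digit_sum (N - p) t)] (mod 2 ^ N)"
    using potential_slope_rep[OF r] by (simp only: cong_minus_minus_iff)
  with potential_slope_rep[OF slope_rep_minus[OF r]] show ?thesis
    by (auto intro: cong_trans cong_sym)
qed

section \<open>Potentials of three vectors with sum zero\<close>

text \<open>
  Since \<open>p < q\<close>, the slopes of \<open>(x, y)\<close> and of the sum agree up to the leading digit of \<open>t\<close>, and
  the change of that digit accounts for the determinant. The digits of \<open>t\<close> that matter after
  multiplication by \<open>2 ^ q\<close> are those of \<open>t'\<close>.
\<close>

lemma potential_add_steeper:
  assumes a: "slope_rep N x y p u t" and b: "slope_rep N x' y' q u' t'"
    and pq: "p < q" and det: "2 ^ (N - 1) dvd x * y' - y * x'"
  shows "[potential N (x + x') (y + y') =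
    potential N x y + potential N x' y' + (x * y' - y * x')] (mod 2 ^ N)"
proof -
  define n d where "n = N - p" and "d = q - p"
  have qN: "q \<le> N" and u: "odd u" "odd u'"
    and x: "[x = 2 ^ p * u] (mod 2 ^ N)" and x': "[x' = 2 ^ q * u'] (mod 2 ^ N)"
    and y: "[y = u * t] (mod 2 ^ n)" and y': "[y' = u' * t'] (mod 2 ^ (n - d))"
    using a b pq by (auto simp: slope_rep_def n_def d_def)
  have q: "q = p + d" and N: "N = p + n" and d: "0 < d" and dn: "d \<le> n"
    using pq qN by (auto simp: n_def d_def)
  obtain k where k: "n = Suc k" using d dn by (cases n) auto
  obtain w where w: "x * y' - y * x' = 2 ^ (N - 1) * w" using det by (elim dvdE)
  define U where "U = u + 2 ^ d * u'"
  have U: "odd U" using u d by (simp add: U_def)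
  obtain T where T: "[y + y' = U * T] (mod 2 ^ n)" using odd_solve_cong U by blast
  have X: "[x + x' = 2 ^ p * U] (mod 2 ^ N)"
    using cong_add[OF x x'] by (simp add: U_def q power_add algebra_simps)
  have ab: "slope_rep N (x + x') (y + y') p U T"
    using U X T N by (simp add: slope_rep_def)
  have "[2 ^ p * (u * y' - 2 ^ d * u' * y) = x * y' - y * x'] (mod 2 ^ N)"
    using cong_diff[OF cong_scalar_right[OF x, of y'] cong_scalar_left[OF x', of y]]
    by (simp add: q power_add algebra_simps cong_sym_eq)
  then have "[2 ^ p * (u * y' - 2 ^ d * u' * y) = 2 ^ p * (2 ^ k * w)] (mod 2 ^ N)"
    by (simp add: w N k power_add mult.assoc)
  then have D: "[u * y' - 2 ^ d * u' * y = 2 ^ k * w] (mod 2 ^ n)"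
    using N by (simp add: power_cong_cmult)
  \<comment> \<open>The slopes are compared after clearing the units \<open>u\<close> and
    \<open>U\<close>; odd factors act trivially on \<open>2 ^ k * w\<close> modulo
    \<open>2 ^ n\<close>.\<close>
  have "[u * U * T = u * (y + y')] (mod 2 ^ n)"
    using cong_scalar_left[OF cong_sym[OF T], of u] by (simp add: mult.assoc)
  also have "u * (y + y') = U * y + (u * y' - 2 ^ d * u' * y)"
    by (simp add: U_def algebra_simps)
  also have "[\<dots> = U * (u * t) + 2 ^ k * w] (mod 2 ^ n)"
    by (intro cong_add cong_scalar_left y D)
  also have "[U * (u * t) + 2 ^ k * w = u * U * (t + 2 ^ k * w)] (mod 2 ^ n)"
  proof -
    have "even (u * U - 1)" using u U by simp
    then have "2 ^ n dvd 2 ^ k * w * (u * U - 1)" by (auto simp: k mult_ac)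
    moreover have "u * U * (t + 2 ^ k * w) - (U * (u * t) + 2 ^ k * w) = 2 ^ k * w * (u * U - 1)"
      by (simp add: algebra_simps)
    ultimately show ?thesis by (subst cong_sym_eq) (simp only: cong_iff_dvd_diff)
  qed
  finally have "[T = t + 2 ^ k * w] (mod 2 ^ n)"
    by (rule odd_cancel_cong[of "u * U", rotated]) (use u U in simp)
  then have "digit_sum n T = digit_sum n (t + 2 ^ k * w)" by (rule digit_sum_cong)
  then have "[digit_sum n T = digit_sum n t + 2 ^ k * w] (mod 2 ^ n)"
    using digit_sum_add_half_power[of k t w] by (simp only: k)
  then have "[U * digit_sum n T = U * (digit_sum n t + 2 ^ k * w)] (mod 2 ^ n)"
    by (rule cong_scalar_left)
  also have "[U * (digit_sum n t + 2 ^ k * w) = U * digit_sum n t + 2 ^ k * w] (mod 2 ^ n)"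
  proof -
    have "even (U - 1)" using U by simp
    then have "2 ^ n dvd 2 ^ k * w * (U - 1)" by (auto simp: k mult_ac)
    moreover have "U * (digit_sum n t + 2 ^ k * w) - (U * digit_sum n t + 2 ^ k * w) = 2 ^ k * w * (U - 1)"
      by (simp add: algebra_simps)
    ultimately show ?thesis by (simp add: cong_iff_dvd_diff)
  qed
  finally have "[2 ^ p * (U * digit_sum n T) = 2 ^ p * (U * digit_sum n t + 2 ^ k * w)] (mod 2 ^ N)"
    using N by (simp add: power_cong_cmult)
  then have Fab: "[potential N (x + x') (y + y') =
      2 ^ p * (U * digit_sum n t + 2 ^ k * w)] (mod 2 ^ N)"
    using potential_slope_rep[OF ab] unfolding n_def[symmetric] mult.assoc
    by (rule cong_trans[rotated])

  \<comment> \<open>As \<open>d > 0\<close>, the determinant vanishes at this lower precision, so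
    both vectors have the same slope there.\<close>
  have m: "(2::int) ^ (n - d) dvd 2 ^ k" using d k by (intro le_imp_power_dvd) simp
  have "[u * y' - 2 ^ d * u' * y = 2 ^ k * w] (mod 2 ^ (n - d))"
    using D by (rule cong_dvd_modulus) (simp add: le_imp_power_dvd)
  also have "[2 ^ k * w = 0] (mod 2 ^ (n - d))" using m by (simp add: cong_0_iff)
  finally have "[u * y' = 2 ^ d * u' * y] (mod 2 ^ (n - d))" by (simp add: cong_diff_iff_cong_0)
  moreover have "[u * y' = u * (u' * t')] (mod 2 ^ (n - d))" using y' by (rule cong_scalar_left)
  moreover have "[2 ^ d * u' * y = 2 ^ d * u' * (u * t)] (mod 2 ^ (n - d))"
    by (rule cong_scalar_left, rule cong_dvd_modulus[OF y]) (simp add: le_imp_power_dvd)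
  ultimately have "[u * (u' * t') = 2 ^ d * u' * (u * t)] (mod 2 ^ (n - d))"
    unfolding cong_def by (simp only:)
  then have "[u * u' * t' = u * u' * (2 ^ d * t)] (mod 2 ^ (n - d))" by (simp add: mult_ac)
  then have "[t' = 2 ^ d * t] (mod 2 ^ (n - d))"
    by (rule odd_cancel_cong[of "u * u'", rotated]) (use u in simp)
  then have "[digit_sum (n - d) t' = digit_sum n t] (mod 2 ^ (n - d))"
    using digit_sum_power_mult_cong[of "n - d" d t] dn by (simp add: digit_sum_cong)
  then have "[u' * digit_sum (n - d) t' = u' * digit_sum n t] (mod 2 ^ (N - q))"
    by (intro cong_scalar_left) (simp add: N q)
  then have "[2 ^ q * (u' * digit_sum (n - d) t') = 2 ^ q * (u' * digit_sum n t)] (mod 2 ^ N)"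
    using qN by (simp add: power_cong_cmult)
  then have Fb: "[potential N x' y' = 2 ^ q * (u' * digit_sum n t)] (mod 2 ^ N)"
    using potential_slope_rep[OF b] by (simp add: N q mult.assoc cong_def)
  have Fa: "[potential N x y = 2 ^ p * (u * digit_sum n t)] (mod 2 ^ N)"
    using potential_slope_rep[OF a] by (simp add: n_def mult.assoc)
  \<comment> \<open>\<open>U\<close> splits into \<open>u\<close> and \<open>2 ^ d * u'\<close> over
    a common digit sum, and \<open>2 ^ p * 2 ^ k\<close> is \<open>2 ^ (N - 1)\<close>.\<close>
  have e: "2 ^ p * (U * digit_sum n t + 2 ^ k * w) =
      2 ^ p * (u * digit_sum n t) + 2 ^ q * (u' * digit_sum n t) + (x * y' - y * x')"
    unfolding w by (simp add: U_def N k q power_add algebra_simps)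
  show ?thesis
    by (rule cong_trans[OF Fab[unfolded e] cong_sym[OF cong_add[OF cong_add[OF Fa Fb] cong_refl]]])
qed

text \<open>The third vector is minus the sum of the others and the potential is odd, so minus the
  determinant appears; the sign is immaterial because twice the determinant is 0 modulo
  \<open>2 ^ N\<close>.\<close>

lemma potential_triple_steeper:
  assumes r: "slope_rep N x1 y1 p1 u1 t1" "slope_rep N x2 y2 p2 u2 t2" and p: "p1 < p2"
    and x: "[x1 + x2 + x3 = 0] (mod 2 ^ N)" and y: "[y1 + y2 + y3 = 0] (mod 2 ^ N)"
    and det: "2 ^ (N - 1) dvd x1 * y2 - y1 * x2"
  shows "2 ^ N dvd potential N x1 y1 + potential N x2 y2 + potential N x3 y3
    - (x1 * y2 - y1 * x2)"
proof -
  have "0 < N" using p r(2) by (simp add: slope_rep_def)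
  then have two: "2 ^ N dvd 2 * (x1 * y2 - y1 * x2)" 
    using mult_dvd_mono[OF dvd_refl[of 2] det] by (cases N) simp_all
  have "[x3 = - (x1 + x2)] (mod 2 ^ N)" "[y3 = - (y1 + y2)] (mod 2 ^ N)"
    using x y by (simp_all add: cong_iff_dvd_diff algebra_simps)
  then have "[potential N x3 y3 = - potential N (x1 + x2) (y1 + y2)] (mod 2 ^ N)"
    by (rule cong_trans[OF potential_cong potential_minus])
  then have 1: "2 ^ N dvd potential N x3 y3 + potential N (x1 + x2) (y1 + y2)"
    by (simp add: cong_iff_dvd_diff)
  have 2: "2 ^ N dvd potential N (x1 + x2) (y1 + y2) -
      (potential N x1 y1 + potential N x2 y2 + (x1 * y2 - y1 * x2))"
    using potential_add_steeper[OF r p det] by (simp only: cong_iff_dvd_diff)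
  show ?thesis
    using dvd_diff[OF dvd_diff[OF 1 2] two] by (simp add: algebra_simps)
qed

text \<open>Here \<open>e\<close> is the determinant \<open>d\<close> after reordering a triple, so
  it is \<open>- d\<close> modulo \<open>m\<close>.\<close>

lemma dvd_diff_minus_swap:
  fixes a d e m :: int
  assumes "m dvd a - e" "m dvd d + e" "m dvd 2 * d"
  shows "m dvd a - d"
proof -
  show ?thesis using dvd_diff[OF dvd_add[OF assms(1,2)] assms(3)] by simp
qed

lemma potential_triple:
  assumes x: "[x1 + x2 + x3 = 0] (mod 2 ^ Suc m)" and y: "[y1 + y2 + y3 = 0] (mod 2 ^ Suc m)"
    and det: "2 ^ m dvd x1 * y2 - y1 * x2"
  shows "2 ^ Suc m dvd potential (Suc m) x1 y1 + potential (Suc m) x2 y2 + potential (Suc m) x3 y3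
    - (x1 * y2 - y1 * x2)"
proof -
  define N where "N = Suc m"
  have x: "[x1 + x2 + x3 = 0] (mod 2 ^ N)" and y: "[y1 + y2 + y3 = 0] (mod 2 ^ N)"
    and det: "2 ^ (N - 1) dvd x1 * y2 - y1 * x2" and two: "2 ^ N dvd 2 * (x1 * y2 - y1 * x2)"
    using assms mult_dvd_mono[OF dvd_refl[of 2] det] by (simp_all add: N_def)
  obtain p1 u1 t1 where r1: "slope_rep N x1 y1 p1 u1 t1" by (rule slope_rep_exists)
  obtain p2 u2 t2 where r2: "slope_rep N x2 y2 p2 u2 t2" by (rule slope_rep_exists)
  obtain p3 u3 t3 where r3: "slope_rep N x3 y3 p3 u3 t3" by (rule slope_rep_exists)
  \<comment> \<open>The minimum of the exponents is attained twice unless it is \<open>N\<close>, and the third one is then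
    larger, because a sum of two odd numbers is even.\<close>
  consider "p1 < p2" | "p2 < p1" | "p1 = p2" "p1 < N" | "p1 = N" "p2 = N"
    using r1 r2 unfolding slope_rep_def by linarith
  then have "2 ^ N dvd potential N x1 y1 + potential N x2 y2 + potential N x3 y3
    - (x1 * y2 - y1 * x2)"
  proof cases
    case 1
    then show ?thesis by (rule potential_triple_steeper[OF r1 r2 _ x y det])
  next
    case 2
    have "2 ^ (N - 1) dvd x2 * y1 - y2 * x1"
      using det by (simp add: dvd_diff_commute mult.commute)
    moreover have "[x2 + x1 + x3 = 0] (mod 2 ^ N)" "[y2 + y1 + y3 = 0] (mod 2 ^ N)"
      using x y by (simp_all add: add.commute)
    ultimately have *: "2 ^ N dvd potential N x2 y2 + potential N x1 y1 + potential N x3 y3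
        - (x2 * y1 - y2 * x1)"
      using potential_triple_steeper[OF r2 r1 2] by blast
    show ?thesis
      by (rule dvd_diff_minus_swap[OF _ _ two, of _ "x2 * y1 - y2 * x1"])
        (use * in \<open>simp_all add: algebra_simps\<close>)
  next
    case 3
    have "2 ^ Suc p1 dvd x3"
    proof -
      have dvd: "(2::int) ^ Suc p1 dvd 2 ^ N" using 3 by (intro le_imp_power_dvd) simp
      have "even (u1 + u2)" using r1 r2 by (simp add: slope_rep_def)
      then have 1: "2 ^ Suc p1 dvd 2 ^ p1 * u1 + 2 ^ p1 * u2"
        by (simp add: mult.commute[of 2] flip: distrib_left)
      have 2: "2 ^ Suc p1 dvd x1 - 2 ^ p1 * u1" "2 ^ Suc p1 dvd x2 - 2 ^ p1 * u2"
        "2 ^ Suc p1 dvd x1 + x2 + x3"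
        using r1 r2 3 x dvd_trans[OF dvd] by (simp_all add: slope_rep_def cong_iff_dvd_diff)
      show ?thesis
        using dvd_diff[OF dvd_diff[OF dvd_diff[OF 2(3) 1] 2(1)] 2(2)] by simp
    qed
    then have p: "p1 < p3" using slope_rep_dvd_iff[OF r3, of "Suc p1"] 3 by simp
    \<comment> \<open>By bilinearity, the determinants of the first vector with the second and with
      the third cancel modulo \<open>2 ^ N\<close>.\<close>
    have "2 ^ N dvd x1 * (y1 + y2 + y3) - y1 * (x1 + x2 + x3)"
      using x y by (simp add: cong_0_iff)
    then have s: "2 ^ N dvd (x1 * y2 - y1 * x2) + (x1 * y3 - y1 * x3)"
      by (simp add: algebra_simps)
    moreover have "(2::int) ^ (N - 1) dvd 2 ^ N" by (simp add: le_imp_power_dvd)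
    ultimately have "2 ^ (N - 1) dvd x1 * y3 - y1 * x3"
      using det dvd_add_right_iff dvd_trans by blast
    moreover have "[x1 + x3 + x2 = 0] (mod 2 ^ N)" "[y1 + y3 + y2 = 0] (mod 2 ^ N)"
      using x y by (simp_all add: ac_simps)
    ultimately have *: "2 ^ N dvd potential N x1 y1 + potential N x3 y3 + potential N x2 y2
        - (x1 * y3 - y1 * x3)"
      using potential_triple_steeper[OF r1 r3 p] by blast
    show ?thesis
      by (rule dvd_diff_minus_swap[OF _ s two]) (use * in \<open>simp add: algebra_simps\<close>)
  next
    case 4
    then have d: "2 ^ N dvd x1" "2 ^ N dvd x2"
      using slope_rep_dvd_iff[OF r1, of N] slope_rep_dvd_iff[OF r2, of N] by simp_all
    have "2 ^ N dvd (x1 + x2 + x3) - x1 - x2"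
      using x d by (intro dvd_diff) (simp_all add: cong_0_iff)
    then have "2 ^ N dvd x3" by simp
    then have "p3 = N"
      using slope_rep_dvd_iff[OF r3, of N] r3 by (simp add: slope_rep_def)
    \<comment> \<open>The factor \<open>2 ^ N\<close> kills all three potentials, and it divides the
      determinant through \<open>x1\<close> and \<open>x2\<close>.\<close>
    then show ?thesis
      using potential_slope_rep[OF r1] potential_slope_rep[OF r2] potential_slope_rep[OF r3] d 4
      by (simp add: cong_0_iff)
  qed
  then show ?thesis by (simp add: N_def)
qed

section \<open>Sums over pairs, and reduction of 2-adic integers\<close>

text \<open>
  Pairing off is needed here: reindexing the sum by \<open>f\<close> would only show that \<open>m\<close> divides its
  double.
\<close>

lemma dvd_sum_involution:
  fixes g :: "'a \<Rightarrow> int"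
  assumes "finite A"
    and "\<And>a. a \<in> A \<Longrightarrow> f a \<in> A" "\<And>a. a \<in> A \<Longrightarrow> f (f a) = a" "\<And>a. a \<in> A \<Longrightarrow> f a \<noteq> a"
    and "\<And>a. a \<in> A \<Longrightarrow> m dvd g a + g (f a)"
  shows "m dvd sum g A"
  using assms
proof (induction A rule: finite_psubset_induct)
  case (psubset A)
  show ?case
  proof (cases "A = {}")
    case False
    then obtain a where a: "a \<in> A" by blast
    let ?B = "A - {a, f a}"
    have inv: "f x \<in> ?B" if "x \<in> ?B" for x
      using that a psubset.prems(1,2) by (metis Diff_iff insert_iff empty_iff)
    have "m dvd sum g ?B"
      by (rule psubset.IH) (use a inv psubset.prems in auto)
    moreover have "sum g A = (g a + g (f a)) + sum g ?B"
      using a psubset.prems psubset.hyps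
      by (subst sum.subset_diff[of "{a, f a}"]) (auto simp: eq_commute)
    ultimately show ?thesis using psubset.prems(4)[OF a] by simp
  qed simp
qed

lemma residue_minus_cong: "[residue (- a) n = - residue a n] (mod 2 ^ n)"
  by (simp add: uminus_two_adic_int.rep_eq cong_def)

lemma residue_sum3_cong:
  assumes "a + b + c = 0"
  shows "[residue a n + residue b n + residue c n = 0] (mod 2 ^ n)"
proof -
  have "residue (a + b + c) n = 0" using assms by (simp add: zero_two_adic_int.rep_eq)
  then show ?thesis by (simp add: plus_two_adic_int.rep_eq cong_def mod_simps)
qed

lemma residue_det2_cong:
  "[residue (det2 a b) n =
    residue (fst a) n * residue (snd b) n - residue (snd a) n * residue (fst b) n] (mod 2 ^ n)"
  by (simp add: det2_def minus_two_adic_int.rep_eq times_two_adic_int.rep_eq cong_def mod_simps)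

text \<open>Modulo \<open>2 ^ Suc m\<close>, a multiple of \<open>2 ^ m\<close> retains only its
  digit \<open>m\<close>, which is 1 exactly at valuation \<open>m\<close>.\<close>

lemma residue_Suc_val2:
  assumes "enat m \<le> val2 x"
  shows "residue x (Suc m) = (if val2 x = enat m then 2 ^ m else 0)"
proof -
  let ?r = "residue x (Suc m)"
  have "enat (Suc m) \<le> val2 x \<longleftrightarrow> val2 x \<noteq> enat m"
    using assms by (cases "val2 x") auto
  then have r0: "?r = 0 \<longleftrightarrow> val2 x \<noteq> enat m"
    by (simp only: le_val2_iff power_two_dvd_iff_residue)
  have "?r mod 2 ^ m = 0"
    using assms by (simp add: residue_Suc le_val2_iff power_two_dvd_iff_residue)
  then obtain j where j: "?r = 2 ^ m * j" by blast
  have "?r = ?r mod 2 ^ Suc m" using residue_add_mod[of x 0 "Suc m"] by simp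
  then have "0 \<le> ?r" "?r < 2 ^ Suc m"
    by (metis pos_mod_sign zero_less_numeral zero_less_power,
        metis pos_mod_bound zero_less_numeral zero_less_power)
  then have "0 \<le> j" "j < 2" by (auto simp: j zero_le_mult_iff)
  then have "j = 0 \<or> j = 1" by auto
  then show ?thesis using r0 j by auto
qed

section \<open>Double counting over the directed edges\<close>

context balanced_graph
begin

definition arc_potential :: "nat \<Rightarrow> 'e \<Rightarrow> int" where
  "arc_potential N e = potential N (residue (fst (B e)) N) (residue (snd (B e)) N)"

lemma arc_potential_arev:
  assumes "e \<in> arcs G"
  shows "2 ^ N dvd arc_potential N e + arc_potential N (arev e)"
proof -
  have "B (arev e) = - B e"
    using balanced_edge[OF assms] by (simp add: add_eq_0_iff)
  then have "[arc_potential N (arev e) = - arc_potential N e] (mod 2 ^ N)"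
    unfolding arc_potential_def
    by (simp add: cong_trans[OF potential_cong[OF residue_minus_cong residue_minus_cong]
          potential_minus])
  then show ?thesis by (simp add: cong_iff_dvd_diff add.commute)
qed

lemma arc_potential_vertex:
  assumes v: "v \<in> verts G" and m: "enat m \<le> vertex_mult G B v"
  shows "2 ^ Suc m dvd (\<Sum>e\<in>in_arcs G v. arc_potential (Suc m) e)
    - (if vertex_mult G B v = enat m then 2 ^ m else 0)"
proof -
  obtain a b c where abc: "in_arcs G v = {a, b, c}" "a \<noteq> b" "a \<noteq> c" "b \<noteq> c"
    using trivalent[OF v] by (auto simp: in_degree_def card_3_iff)
  have mult: "vertex_mult G B v = val2 (det2 (B a) (B b))"
    using vertex_mult_eq[OF v, of a b] abc by blast
  have sum0: "B a + B b + B c = 0"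
    using balanced_vertex[OF v] abc by (simp add: add.assoc)
  let ?x = "\<lambda>e. residue (fst (B e)) (Suc m)" and ?y = "\<lambda>e. residue (snd (B e)) (Suc m)"
  have x: "[?x a + ?x b + ?x c = 0] (mod 2 ^ Suc m)"
    using arg_cong[OF sum0, of fst] by (intro residue_sum3_cong) simp
  have y: "[?y a + ?y b + ?y c = 0] (mod 2 ^ Suc m)"
    using arg_cong[OF sum0, of snd] by (intro residue_sum3_cong) simp
  let ?\<delta> = "if vertex_mult G B v = enat m then 2 ^ m else 0 :: int"
  have \<delta>: "2 ^ Suc m dvd ?x a * ?y b - ?y a * ?x b - ?\<delta>"
    using residue_det2_cong[of "B a" "B b" "Suc m"] residue_Suc_val2[OF m[unfolded mult]]
    unfolding mult by (simp only: cong_iff_dvd_diff dvd_diff_commute)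
  have "(2::int) ^ m dvd 2 ^ Suc m" "2 ^ m dvd ?\<delta>" by simp_all
  from dvd_add[OF dvd_trans[OF this(1) \<delta>] this(2)]
  have "2 ^ m dvd ?x a * ?y b - ?y a * ?x b" by (simp only: diff_add_cancel)
  from dvd_add[OF potential_triple[OF x y this] \<delta>] show ?thesis
    using abc by (simp add: arc_potential_def algebra_simps)
qed

lemma sum_in_arcs:
  assumes "fin_digraph G"
  shows "(\<Sum>v\<in>verts G. \<Sum>e\<in>in_arcs G v. g e) = sum g (arcs G)"
proof -
  interpret fin_digraph G by (rule assms)
  show ?thesis unfolding in_arcs_def by (rule sum.group) auto
qed

lemma even_card_min_vertex_mult:
  assumes fin: "fin_digraph G" and le: "\<And>v. v \<in> verts G \<Longrightarrow> M \<le> vertex_mult G B v"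
  shows "even (card {v \<in> verts G. vertex_mult G B v = M})"
proof -
  interpret fin_digraph G by (rule fin)
  let ?V = "{v \<in> verts G. vertex_mult G B v = M}"
  show ?thesis
  proof (cases M)
    case (enat m)
    let ?P = "arc_potential (Suc m)"
    let ?\<delta> = "\<lambda>v. if vertex_mult G B v = enat m then 2 ^ m else 0 :: int"
    have "2 ^ Suc m dvd (\<Sum>v\<in>verts G. (\<Sum>e\<in>in_arcs G v. ?P e) - ?\<delta> v)"
      using le by (intro dvd_sum arc_potential_vertex) (simp_all add: enat)
    moreover have "2 ^ Suc m dvd sum ?P (arcs G)"
      by (rule dvd_sum_involution[where f = arev])
        (simp_all only: finite_arcs arev_in_arcs arev_arev arev_neq arc_potential_arev not_False_eq_True)
    ultimately have "2 ^ Suc m dvd (\<Sum>v\<in>verts G. ?\<delta> v)"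
      unfolding sum_subtractf sum_in_arcs[OF fin] by (simp only: dvd_diff_right_iff)
    also have "(\<Sum>v\<in>verts G. ?\<delta> v) = 2 ^ m * int (card ?V)"
      by (simp add: enat sum.If_cases Int_def mult.commute)
    finally show ?thesis by simp
  next
    case infinity
    have "2 dvd (\<Sum>e\<in>arcs G. 1 :: int)"
      by (rule dvd_sum_involution[where f = arev]) (simp_all add: arev_neq)
    also have "(\<Sum>e\<in>arcs G. 1 :: int) = (\<Sum>v\<in>verts G. \<Sum>e\<in>in_arcs G v. 1)"
      by (rule sum_in_arcs[OF fin, symmetric])
    also have "\<dots> = 3 * int (card (verts G))"
      using trivalent by (simp add: in_degree_def)
    finally have "even (card (verts G))" by simp
    moreover have "?V = verts G" using le by (auto simp: infinity)
    ultimately show ?thesis by simp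
  qed
qed

end

theorem theorem1:
  fixes G :: "('v, 'e) pre_digraph" and arev :: "'e \<Rightarrow> 'e"
    and B :: "'e \<Rightarrow> two_adic_int \<times> two_adic_int"
  assumes "balanced_graph G arev B"
    and "fin_digraph G"
  shows "even (card {v \<in> verts G. vertex_mult G B v = Min (vertex_mult G B ` verts G)})"
proof -
  interpret balanced_graph G arev B by (rule assms(1))
  interpret fin_digraph G by (rule assms(2))
  \<comment> \<open>On the empty graph \<open>Min\<close> is an unspecified value, but the bound is
    then vacuous.\<close>
  show ?thesis by (rule even_card_min_vertex_mult[OF assms(2)]) simp
qed

end
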